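(* Let $A$ be a $C^*$-algebra, $\mathcal{H}$ a Hilbert space, $\varphi:A\to L(\mathcal{H})$ a completely positive linear map and $(\pi,\mathcal{H}_\varphi,V_\varphi)$ a minimal Stinespring dilation triple of $\varphi$. Then for every Hilbert $A$-module $X$, all Hilbert spaces $\mathcal{K},\widetilde{\mathcal{K}}$, every $\pi$-representation $\Pi:X\to L(\mathcal{H}_\varphi,\mathcal{K})$ and every $\varphi$-map $\Phi:X\to L(\mathcal{H},\widetilde{\mathcal{K}})$, there is a partial isometry $W:\widetilde{\mathcal{K}}\to\mathcal{K}$ such that $\Phi(\cdot)=W^*\Pi(\cdot)V_\varphi$ and, for every $x\in X$, the following statements are equivalent: (1) $x\in X_\varphi$; (2) $\Pi(x)(\mathrm{id}_{\mathcal{H}_\varphi}-V_\varphi V_\varphi^* )=0$; (3) $W^*\Pi(x)=\Phi(x)V_\varphi^*$; (4) $\Pi(x)=W\Phi(x)V_\varphi^*$.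
   Context: Hilbert $C^*$-modules are right modules, with inner product linear in the second variable. $L(\mathcal{H},\mathcal{K})$ denotes bounded linear operators, $L(\mathcal{H})=L(\mathcal{H},\mathcal{H})$, and $[\,\cdot\,]$ closed linear span. For a linear map $\psi:A\to L(\mathcal{H})$, a $\psi$-map is a map $\Phi:X\to L(\mathcal{H},\mathcal{K})$ with $\Phi(x)^*\Phi(y)=\psi(\langle x,y\rangle)$ for all $x,y\in X$; when $\psi$ is a $*$-homomorphism it is called a $\psi$-representation. A minimal Stinespring dilation triple of $\varphi$ is a triple $(\pi,\mathcal{H}_\varphi,V_\varphi)$ where $\pi:A\to L(\mathcal{H}_\varphi)$ is a $*$-representation, $V_\varphi:\mathcal{H}\to\mathcal{H}_\varphi$ is bounded linear, $\varphi(a)=V_\varphi^*\pi(a)V_\varphi$ for all $a\in A$, and $[\pi(A)V_\varphi\mathcal{H}]=\mathcal{H}_\varphi$. Let $M_\varphi=\{a\in A:\varphi(ab)=\varphi(a)\varphi(b),\ \varphi(ba)=\varphi(b)\varphi(a)\ \forall b\in A\}$ and $T_\varphi=\{a\in M_\varphi:\varphi(ba^*c)=\varphi(b)\varphi(a)^*\varphi(c)\ \forall b,c\in A\}$. The ternary domain $X_\varphi$ of $\varphi$ on $X$ is the set $\{x\in X:\Phi(xb)=\Phi(x)\varphi(b)\text{ for all }b\in A\}$, where $\Phi$ is any operator-valued $\varphi$-map on $X$; such maps exist and the set is the same for every choice of $\Phi$ (equivalently $X_\varphi=\{x\in X:\langle x,x\rangle\in T_\varphi\}$). *)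

theory Defs
  imports "HOL-Analysis.Analysis" "HOL-Library.Nonpos_Ints"
begin

section \<open>Complex Hilbert spaces and bounded operators\<close>

class scaleC =
  fixes scaleC :: "complex \<Rightarrow> 'a \<Rightarrow> 'a" (infixr "*\<^sub>C" 75)

class complex_vector = real_vector + scaleC +
  assumes scaleC_add_right: "c *\<^sub>C (x + y) = c *\<^sub>C x + c *\<^sub>C y"
    and scaleC_add_left: "(c + d) *\<^sub>C x = c *\<^sub>C x + d *\<^sub>C x"
    and scaleC_scaleC: "c *\<^sub>C (d *\<^sub>C x) = (c * d) *\<^sub>C x"
    and scaleC_one: "1 *\<^sub>C x = x"
    and scaleR_scaleC: "r *\<^sub>R x = complex_of_real r *\<^sub>C x"

class complex_normed_vector = real_normed_vector + complex_vector +
  assumes norm_scaleC: "norm (c *\<^sub>C x) = cmod c * norm x"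

text \<open>The inner product is linear in the second variable. Positivity and definiteness
  are contained in \<open>cinner_self\<close>.\<close>

class chilbert_space = complex_normed_vector + complete_space +
  fixes cinner :: "'a \<Rightarrow> 'a \<Rightarrow> complex"
  assumes cinner_commute: "cinner x y = cnj (cinner y x)"
    and cinner_add_right: "cinner x (y + z) = cinner x y + cinner x z"
    and cinner_scaleC_right: "cinner x (c *\<^sub>C y) = c * cinner x y"
    and cinner_self: "cinner x x = complex_of_real ((norm x)\<^sup>2)"

lemma vector_space_scaleC: "vector_space (scaleC :: complex \<Rightarrow> 'a \<Rightarrow> 'a::complex_vector)"
  by unfold_locales (simp_all add: scaleC_add_right scaleC_add_left scaleC_scaleC scaleC_one)

definition cspan :: "'a::complex_vector set \<Rightarrow> 'a set" where
  "cspan S = module.span scaleC S"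

definition bounded_clinear :: "('a::complex_normed_vector \<Rightarrow> 'b::complex_normed_vector) \<Rightarrow> bool" where
  "bounded_clinear f \<longleftrightarrow> bounded_linear f \<and> (\<forall>c x. f (c *\<^sub>C x) = c *\<^sub>C f x)"

text \<open>Only meaningful for \<open>bounded_clinear\<close> maps, whose adjoint exists uniquely.\<close>

definition cadjoint :: "('a::chilbert_space \<Rightarrow> 'b::chilbert_space) \<Rightarrow> 'b \<Rightarrow> 'a" where
  "cadjoint f = (SOME g. \<forall>x y. cinner (f x) y = cinner x (g y))"

definition partial_isometry :: "('a::chilbert_space \<Rightarrow> 'b::chilbert_space) \<Rightarrow> bool" where
  "partial_isometry W \<longleftrightarrow> bounded_clinear W \<and>
     (\<forall>x. (\<forall>y. W y = 0 \<longrightarrow> cinner y x = 0) \<longrightarrow> norm (W x) = norm x)"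


section \<open>C*-algebras and Hilbert modules\<close>

text \<open>No unit is assumed.\<close>

class cstar_algebra = real_normed_algebra + complex_normed_vector + complete_space +
  fixes cstar :: "'a \<Rightarrow> 'a" ("(_\<^sup>\<star>)" [1000] 999)
  assumes mult_scaleC_left: "(c *\<^sub>C x) * y = c *\<^sub>C (x * y)"
    and mult_scaleC_right: "x * (c *\<^sub>C y) = c *\<^sub>C (x * y)"
    and cstar_cstar: "(x\<^sup>\<star>)\<^sup>\<star> = x"
    and cstar_add: "(x + y)\<^sup>\<star> = x\<^sup>\<star> + y\<^sup>\<star>"
    and cstar_scaleC: "(c *\<^sub>C x)\<^sup>\<star> = cnj c *\<^sub>C x\<^sup>\<star>"
    and cstar_mult: "(x * y)\<^sup>\<star> = y\<^sup>\<star> * x\<^sup>\<star>"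
    and cstar_identity: "norm (x\<^sup>\<star> * x) = (norm x)\<^sup>2"

definition cstar_positive :: "'a::cstar_algebra \<Rightarrow> bool" where
  "cstar_positive a \<longleftrightarrow> (\<exists>b. a = b\<^sup>\<star> * b)"

text \<open>A Hilbert C*-module is the whole type \<open>'x\<close>, complete for its class norm; \<open>norm_ip\<close>
  identifies that norm with the one induced by the inner product \<open>ip\<close>, and thereby also
  makes \<open>ip\<close> definite.\<close>

locale hilbert_module =
  fixes act :: "'x::{complex_normed_vector, complete_space} \<Rightarrow> 'a::cstar_algebra \<Rightarrow> 'x"
    and ip :: "'x \<Rightarrow> 'x \<Rightarrow> 'a"
  assumes act_add_left: "act (x + y) a = act x a + act y a"
    and act_add_right: "act x (a + b) = act x a + act x b"
    and act_mult: "act x (a * b) = act (act x a) b"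
    and act_scaleC_left: "act (c *\<^sub>C x) a = c *\<^sub>C act x a"
    and act_scaleC_right: "act x (c *\<^sub>C a) = c *\<^sub>C act x a"
    and ip_add_right: "ip x (y + z) = ip x y + ip x z"
    and ip_scaleC_right: "ip x (c *\<^sub>C y) = c *\<^sub>C ip x y"
    and ip_act_right: "ip x (act y a) = ip x y * a"
    and cstar_ip: "(ip x y)\<^sup>\<star> = ip y x"
    and ip_positive: "cstar_positive (ip x x)"
    and norm_ip: "norm x = sqrt (norm (ip x x))"


section \<open>Completely positive maps, representations and dilations\<close>

definition op_linear ::
  "('a::cstar_algebra \<Rightarrow> 'h::chilbert_space \<Rightarrow> 'h) \<Rightarrow> bool" where
  "op_linear \<phi> \<longleftrightarrow> (\<forall>a. bounded_clinear (\<phi> a)) \<and>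
     (\<forall>a b h. \<phi> (a + b) h = \<phi> a h + \<phi> b h) \<and>
     (\<forall>c a h. \<phi> (c *\<^sub>C a) h = c *\<^sub>C \<phi> a h)"

text \<open>An \<open>n \<times> n\<close> matrix is a function of two indices, of which only the values at indices
  below \<open>n\<close> matter. A positive element of the C*-algebra of matrices over \<open>'a\<close> is one of the
  form \<open>B\<^sup>\<star>B\<close>; a matrix of operators on \<open>'h\<close> is positive if it is a positive operator on
  the \<open>n\<close>-fold direct sum of \<open>'h\<close>.\<close>

definition mat_positive :: "nat \<Rightarrow> (nat \<Rightarrow> nat \<Rightarrow> 'a::cstar_algebra) \<Rightarrow> bool" where
  "mat_positive n M \<longleftrightarrow> (\<exists>B. \<forall>i<n. \<forall>j<n. M i j = (\<Sum>k<n. (B k i)\<^sup>\<star> * B k j))"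

definition op_mat_positive :: "nat \<Rightarrow> (nat \<Rightarrow> nat \<Rightarrow> 'h \<Rightarrow> 'h::chilbert_space) \<Rightarrow> bool" where
  "op_mat_positive n T \<longleftrightarrow>
     (\<forall>h. (\<Sum>i<n. cinner (h i) (\<Sum>j<n. T i j (h j))) \<in> \<real>\<^sub>\<ge>\<^sub>0)"

definition completely_positive ::
  "('a::cstar_algebra \<Rightarrow> 'h::chilbert_space \<Rightarrow> 'h) \<Rightarrow> bool" where
  "completely_positive \<phi> \<longleftrightarrow> op_linear \<phi> \<and>
     (\<forall>n M. mat_positive n M \<longrightarrow> op_mat_positive n (\<lambda>i j. \<phi> (M i j)))"

definition star_representation ::
  "('a::cstar_algebra \<Rightarrow> 'h::chilbert_space \<Rightarrow> 'h) \<Rightarrow> bool" where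
  "star_representation \<pi> \<longleftrightarrow> op_linear \<pi> \<and>
     (\<forall>a b. \<pi> (a * b) = \<pi> a \<circ> \<pi> b) \<and> (\<forall>a. \<pi> (a\<^sup>\<star>) = cadjoint (\<pi> a))"

definition minimal_stinespring ::
  "('a::cstar_algebra \<Rightarrow> 'h::chilbert_space \<Rightarrow> 'h) \<Rightarrow>
   ('a \<Rightarrow> 'hphi::chilbert_space \<Rightarrow> 'hphi) \<Rightarrow> ('h \<Rightarrow> 'hphi) \<Rightarrow> bool" where
  "minimal_stinespring \<phi> \<pi> V \<longleftrightarrow>
     star_representation \<pi> \<and> bounded_clinear V \<and>
     (\<forall>a. \<phi> a = cadjoint V \<circ> \<pi> a \<circ> V) \<and>
     closure (cspan {\<pi> a (V h) | a h. True}) = UNIV"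

text \<open>Module maps into \<open>L(\<H>, \<K>)\<close> are not assumed to be linear.\<close>

definition module_map ::
  "('x \<Rightarrow> 'x \<Rightarrow> 'a) \<Rightarrow> ('a \<Rightarrow> 'h::chilbert_space \<Rightarrow> 'h) \<Rightarrow>
   ('x \<Rightarrow> 'h \<Rightarrow> 'k::chilbert_space) \<Rightarrow> bool" where
  "module_map ip \<psi> \<Phi> \<longleftrightarrow> (\<forall>x. bounded_clinear (\<Phi> x)) \<and>
     (\<forall>x y. cadjoint (\<Phi> x) \<circ> \<Phi> y = \<psi> (ip x y))"

definition module_representation ::
  "('x \<Rightarrow> 'x \<Rightarrow> 'a::cstar_algebra) \<Rightarrow> ('a \<Rightarrow> 'h::chilbert_space \<Rightarrow> 'h) \<Rightarrow>
   ('x \<Rightarrow> 'h \<Rightarrow> 'k::chilbert_space) \<Rightarrow> bool" where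
  "module_representation ip \<pi> \<Theta> \<longleftrightarrow> star_representation \<pi> \<and> module_map ip \<pi> \<Theta>"

text \<open>The ternary domain of \<open>\<phi>\<close>, computed with the \<open>\<phi>\<close>-map \<open>\<Phi>\<close>. It does not depend on
  the choice of \<open>\<Phi>\<close>, but the target type of \<open>\<Phi>\<close> cannot be quantified inside a definition,
  so \<open>\<Phi>\<close> remains a parameter.\<close>

definition ternary_domain ::
  "('x \<Rightarrow> 'a \<Rightarrow> 'x) \<Rightarrow> ('a \<Rightarrow> 'h \<Rightarrow> 'h) \<Rightarrow> ('x \<Rightarrow> 'h \<Rightarrow> 'k) \<Rightarrow> 'x set" where
  "ternary_domain act \<phi> \<Phi> = {x. \<forall>b. \<Phi> (act x b) = \<Phi> x \<circ> \<phi> b}"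

end

theory Submission
  imports Defs
begin

text \<open>
  The \<open>\<phi>\<close>-map \<open>\<Phi>\<close> and the dilated map \<open>\<Theta>(\<cdot>)V\<close> have the same inner products:
  \<open>\<langle>\<Phi>(x)h, \<Phi>(y)k\<rangle> = \<langle>h, \<phi>(\<langle>x,y\<rangle>)k\<rangle> = \<langle>h, V\<^sup>*\<pi>(\<langle>x,y\<rangle>)Vk\<rangle> = \<langle>\<Theta>(x)Vh, \<Theta>(y)Vk\<rangle>\<close>.
  Two families of vectors with equal Gram matrices are exchanged by a partial isometry
  (\<open>partial_isometry_of_equal_Gram\<close>), which gives \<open>W\<close> with \<open>W\<Phi>(x) = \<Theta>(x)V\<close> and
  \<open>W\<^sup>*\<Theta>(x)V = \<Phi>(x)\<close>.

  The second ingredient is that \<open>\<Theta>\<close> satisfies \<open>\<Theta>(xa) = \<Theta>(x)\<pi>(a)\<close> (\<open>module_map_act\<close>), because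
  \<open>\<pi>\<close> is multiplicative. Minimality says that the vectors \<open>\<pi>(a)Vh\<close> are total, so the range of
  \<open>\<Theta>(x)\<close> lies in the closed span of the vectors \<open>\<Theta>(y)Vh\<close>, the final space of \<open>W\<close>. Hence
  \<open>WW\<^sup>*\<Theta>(x) = \<Theta>(x)\<close> (\<open>intertwining_partial_isometry_exists\<close>).

  The equivalences are then algebra. Since \<open>\<Phi>(x)V\<^sup>* = W\<^sup>*\<Theta>(x)VV\<^sup>*\<close>, multiplication by \<open>W\<close> and
  by \<open>W\<^sup>*\<close> turns each of the last three conditions into \<open>\<Theta>(x) = \<Theta>(x)VV\<^sup>*\<close>. For the ternary domain,
  \<open>\<Phi>(xb) = \<Phi>(x)\<phi>(b)\<close> becomes \<open>\<Theta>(x)\<pi>(b)V = \<Theta>(x)VV\<^sup>*\<pi>(b)V\<close> after multiplication by \<open>W\<close>, and by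
  minimality this holds for all \<open>b\<close> exactly when \<open>\<Theta>(x) = \<Theta>(x)VV\<^sup>*\<close>. The argument applies to
  each \<open>\<phi>\<close>-map with its own \<open>W\<close>, so the ternary domain is the same for all of them.
\<close>

section \<open>Geometry of complex Hilbert spaces\<close>

interpretation cvec: vector_space "scaleC :: complex \<Rightarrow> 'a \<Rightarrow> 'a::complex_vector"
  by (rule vector_space_scaleC)

lemma scaleC_minus_one: "(-1) *\<^sub>C x = - (x::'a::complex_vector)"
  using scaleR_scaleC[of "-1" x] by simp

lemma cinner_add_left: "cinner (x + y) z = cinner x z + cinner y z"
  by (metis cinner_add_right cinner_commute complex_cnj_add)

lemma cinner_scaleC_left: "cinner (c *\<^sub>C x) y = cnj c * cinner x y"
  by (metis cinner_commute cinner_scaleC_right complex_cnj_mult)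

lemma cinner_minus_right: "cinner x (- y) = - cinner x y"
  using cinner_scaleC_right[of x "-1" y] by (simp add: scaleC_minus_one)

lemma cinner_minus_left: "cinner (- x) y = - cinner x y"
  using cinner_scaleC_left[of "-1" x y] by (simp add: scaleC_minus_one)

lemma cinner_diff_right: "cinner x (y - z) = cinner x y - cinner x z"
  using cinner_add_right[of x y "- z"] by (simp add: cinner_minus_right)

lemma cinner_diff_left: "cinner (x - y) z = cinner x z - cinner y z"
  using cinner_add_left[of x "- y" z] by (simp add: cinner_minus_left)

lemma cinner_zero_right [simp]: "cinner x 0 = 0"
  using cinner_scaleC_right[of x 0 0] by simp

lemma cinner_zero_left [simp]: "cinner 0 x = 0"
  using cinner_scaleC_left[of 0 0 x] by simp

lemma cinner_self_eq_0_iff [simp]: "cinner x x = 0 \<longleftrightarrow> x = 0"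
  by (simp add: cinner_self)

lemma cinner_ext_left:
  assumes "\<And>x. cinner x y = cinner x z"
  shows "y = z"
  using assms[of "y - z"] cinner_diff_right[of "y - z" y z] by simp

lemma norm_sq_eq_Re_cinner: "(norm x)\<^sup>2 = Re (cinner x x)"
  by (simp add: cinner_self)

lemma parallelogram_law:
  fixes x y :: "'a::chilbert_space"
  shows "(norm (x + y))\<^sup>2 + (norm (x - y))\<^sup>2 = 2 * (norm x)\<^sup>2 + 2 * (norm y)\<^sup>2"
  by (simp add: norm_sq_eq_Re_cinner cinner_add_left cinner_add_right cinner_diff_left cinner_diff_right)

lemma norm_sq_sub_component:
  fixes x s :: "'a::chilbert_space"
  assumes "s \<noteq> 0"
  shows "(norm (x - (cinner s x / cinner s s) *\<^sub>C s))\<^sup>2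
    = (norm x)\<^sup>2 - (cmod (cinner s x))\<^sup>2 / (norm s)\<^sup>2"
proof -
  define c where "c = cinner s x / cinner s s"
  have c: "c * cinner s s = cinner s x"
    using assms by (simp add: c_def)
  have "cinner (x - c *\<^sub>C s) (x - c *\<^sub>C s)
      = cinner x x - c * cinner x s - cnj c * (cinner s x - c * cinner s s)"
    by (simp add: cinner_diff_left cinner_diff_right cinner_scaleC_left cinner_scaleC_right
        algebra_simps)
  also have "\<dots> = cinner x x - c * cinner x s"
    by (simp add: c)
  also have "c * cinner x s = complex_of_real ((cmod (cinner s x))\<^sup>2 / (norm s)\<^sup>2)"
    using complex_norm_square[of "cinner s x"] cinner_commute[of x s]
    by (simp add: c_def cinner_self)
  finally have "complex_of_real ((norm (x - c *\<^sub>C s))\<^sup>2)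
      = complex_of_real ((norm x)\<^sup>2 - (cmod (cinner s x))\<^sup>2 / (norm s)\<^sup>2)"
    by (simp add: cinner_self)
  then show ?thesis
    unfolding c_def of_real_eq_iff .
qed

lemma Cauchy_Schwarz: "cmod (cinner x y) \<le> norm x * norm y"
proof (cases "x = 0")
  case False
  have "(cmod (cinner x y))\<^sup>2 / (norm x)\<^sup>2 \<le> (norm y)\<^sup>2"
    using norm_sq_sub_component[OF False, of y]
    by (metis diff_ge_0_iff_ge zero_le_power2)
  then have "(cmod (cinner x y))\<^sup>2 \<le> (norm x * norm y)\<^sup>2"
    using False by (simp add: divide_le_eq power_mult_distrib mult.commute)
  then show ?thesis
    by (simp add: power2_le_iff_abs_le)
qed simp

lemma bounded_bilinear_cinner: "bounded_bilinear cinner"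
proof
  show "\<exists>K. \<forall>a b. cmod (cinner a b) \<le> norm a * norm b * K"
    by (intro exI[of _ 1]) (simp add: Cauchy_Schwarz)
qed (simp_all add: cinner_add_left cinner_add_right scaleR_scaleC cinner_scaleC_left
    cinner_scaleC_right scaleR_conv_of_real)

lemmas tendsto_cinner = bounded_bilinear.tendsto[OF bounded_bilinear_cinner]

text \<open>By the parallelogram law a sequence in \<open>S\<close> whose distances to \<open>x\<close> approach the infimum is
  Cauchy. Its limit \<open>p\<close> is a closest point, and subtracting from \<open>x - p\<close> its component along some
  \<open>s\<close> in \<open>S\<close> could only bring it closer.\<close>

lemma orthogonal_projection_exists:
  fixes S :: "'a::chilbert_space set"
  assumes sub: "module.subspace scaleC S" and "closed S"
  shows "\<exists>p\<in>S. \<forall>s\<in>S. cinner s (x - p) = 0"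
proof -
  have ne: "S \<noteq> {}" and add: "\<And>u v. u \<in> S \<Longrightarrow> v \<in> S \<Longrightarrow> u + v \<in> S"
    and scale: "\<And>c u. u \<in> S \<Longrightarrow> c *\<^sub>C u \<in> S"
    using cvec.subspace_0[OF sub] cvec.subspace_add[OF sub] cvec.subspace_scale[OF sub] by auto
  define d where "d = infdist x S"
  have d0: "0 \<le> d"
    by (simp add: d_def infdist_nonneg)
  have dle: "d \<le> norm (x - s)" if "s \<in> S" for s
    using infdist_le[OF that, of x] by (simp add: d_def dist_norm)
  have "\<exists>s\<in>S. dist x s < d + inverse (real (Suc n))" for n
  proof -
    have "d < d + inverse (real (Suc n))"
      by simp
    then show ?thesis
      unfolding d_def infdist_notempty[OF ne]
      by (subst (asm) cINF_less_iff) (use ne in \<open>auto intro!: bdd_belowI[of _ 0]\<close>)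
  qed
  then obtain u where uS: "\<And>n. u n \<in> S" and u: "\<And>n. dist x (u n) < d + inverse (real (Suc n))"
    by metis
  have lim: "(\<lambda>n. norm (x - u n)) \<longlonglongrightarrow> d"
  proof (rule tendsto_sandwich[where f = "\<lambda>n. d" and h = "\<lambda>n. d + inverse (real (Suc n))"])
    show "(\<lambda>n. d + inverse (real (Suc n))) \<longlonglongrightarrow> d"
      using tendsto_add[OF tendsto_const[of d] LIMSEQ_inverse_real_of_nat] by simp
  qed (use dle uS u in \<open>auto simp: dist_norm intro!: always_eventually less_imp_le\<close>)
  have gap: "(norm (u m - u n))\<^sup>2 \<le> 2 * ((norm (x - u m))\<^sup>2 - d\<^sup>2) + 2 * ((norm (x - u n))\<^sup>2 - d\<^sup>2)"
    for m n
  proof -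
    let ?w = "(1/2) *\<^sub>R (u m + u n)"
    have "?w \<in> S"
      using add scale uS by (simp add: scaleR_scaleC)
    then have "d\<^sup>2 \<le> (norm (x - ?w))\<^sup>2"
      using dle d0 by (simp add: power_mono)
    moreover have "(x - u n) + (x - u m) = 2 *\<^sub>R (x - ?w)"
      by (simp add: algebra_simps flip: scaleR_2)
    then have "(norm ((x - u n) + (x - u m)))\<^sup>2 = 4 * (norm (x - ?w))\<^sup>2"
      by (simp add: power_mult_distrib)
    moreover have "(x - u n) - (x - u m) = u m - u n"
      by simp
    ultimately show ?thesis
      using parallelogram_law[of "x - u n" "x - u m"] by simp
  qed
  have "Cauchy u"
  proof (rule metric_CauchyI)
    fix e :: real
    assume "0 < e"
    have "(\<lambda>n. (norm (x - u n))\<^sup>2 - d\<^sup>2) \<longlonglongrightarrow> d\<^sup>2 - d\<^sup>2"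
      by (intro tendsto_intros lim)
    then have "\<forall>\<^sub>F n in sequentially. (norm (x - u n))\<^sup>2 - d\<^sup>2 < e\<^sup>2 / 4"
      using \<open>0 < e\<close> by (intro order_tendstoD(2)) auto
    then obtain N where N: "\<And>n. n \<ge> N \<Longrightarrow> (norm (x - u n))\<^sup>2 - d\<^sup>2 < e\<^sup>2 / 4"
      by (auto simp: eventually_sequentially)
    have "dist (u m) (u n) < e" if "m \<ge> N" "n \<ge> N" for m n
    proof -
      have "(norm (u m - u n))\<^sup>2 < e\<^sup>2"
        using gap[of m n] N[OF that(1)] N[OF that(2)] by argo
      then show ?thesis
        using \<open>0 < e\<close> by (simp add: dist_norm power2_less_imp_less)
    qed
    then show "\<exists>M. \<forall>m\<ge>M. \<forall>n\<ge>M. dist (u m) (u n) < e"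
      by blast
  qed
  then obtain p where p: "u \<longlonglongrightarrow> p"
    using Cauchy_convergent convergent_def by blast
  have pS: "p \<in> S"
    using \<open>closed S\<close> uS p by (meson closed_sequentially)
  have pd: "norm (x - p) = d"
    using LIMSEQ_unique[OF tendsto_norm[OF tendsto_diff[OF tendsto_const p]] lim] .
  have "cinner s (x - p) = 0" if "s \<in> S" for s
  proof (cases "s = 0")
    case False
    let ?c = "cinner s (x - p) / cinner s s"
    have "d \<le> norm (x - (p + ?c *\<^sub>C s))"
      using add scale pS that by (intro dle) auto
    then have "d\<^sup>2 \<le> (norm (x - p - ?c *\<^sub>C s))\<^sup>2"
      using d0 by (simp add: power_mono diff_diff_add)
    then have "(cmod (cinner s (x - p)))\<^sup>2 / (norm s)\<^sup>2 \<le> 0"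
      using norm_sq_sub_component[OF False, of "x - p"] pd by simp
    then show ?thesis
      using False by (simp add: divide_le_0_iff)
  qed simp
  with pS show ?thesis
    by blast
qed

section \<open>Bounded operators and adjoints\<close>

lemma bounded_clinear_add: "bounded_clinear f \<Longrightarrow> f (x + y) = f x + f y"
  by (simp add: bounded_clinear_def bounded_linear.linear linear_add)

lemma bounded_clinear_diff: "bounded_clinear f \<Longrightarrow> f (x - y) = f x - f y"
  by (simp add: bounded_clinear_def bounded_linear.linear linear_diff)

lemma bounded_clinear_zero: "bounded_clinear f \<Longrightarrow> f 0 = 0"
  by (simp add: bounded_clinear_def bounded_linear.linear linear_0)

lemma bounded_clinear_scaleC: "bounded_clinear f \<Longrightarrow> f (c *\<^sub>C x) = c *\<^sub>C f x"
  by (simp add: bounded_clinear_def)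

lemma bounded_clinear_tendsto:
  "bounded_clinear f \<Longrightarrow> (X \<longlongrightarrow> l) F \<Longrightarrow> ((\<lambda>n. f (X n)) \<longlongrightarrow> f l) F"
  by (simp add: bounded_clinear_def bounded_linear.tendsto)

lemma bounded_clinearI:
  assumes "\<And>x y. f (x + y) = f x + f y" "\<And>c x. f (c *\<^sub>C x) = c *\<^sub>C f x"
    "\<And>x. norm (f x) \<le> norm x * K"
  shows "bounded_clinear f"
  unfolding bounded_clinear_def
proof
  show "bounded_linear f"
    by (rule bounded_linear_intro[where K = K]) (simp_all add: scaleR_scaleC assms)
qed (simp add: assms)

lemma bounded_clinear_scaleC_op: "bounded_clinear (\<lambda>x. c *\<^sub>C x)"
  by (rule bounded_clinearI[where K = "cmod c"])
    (simp_all add: scaleC_add_right scaleC_scaleC mult.commute norm_scaleC)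

lemma bounded_clinear_compose:
  assumes "bounded_clinear f" "bounded_clinear g"
  shows "bounded_clinear (f \<circ> g)"
  using assms by (auto simp: bounded_clinear_def comp_def intro: bounded_linear_compose)

lemma bounded_clinear_eq_on_dense_cspan:
  assumes f: "bounded_clinear f" and g: "bounded_clinear g"
    and dense: "closure (cspan S) = UNIV" and eq: "\<And>x. x \<in> S \<Longrightarrow> f x = g x"
  shows "f = g"
proof -
  let ?E = "{x. f x = g x}"
  have "cvec.subspace ?E"
    using f g by (auto simp: cvec.subspace_def bounded_clinear_add bounded_clinear_scaleC
        bounded_clinear_zero)
  then have "cspan S \<subseteq> ?E"
    unfolding cspan_def using eq by (intro cvec.span_minimal) auto
  moreover have "closed ?E"
    using f g by (intro closed_Collect_eq) (auto simp: bounded_clinear_def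
        intro: linear_continuous_on)
  ultimately have "closure (cspan S) \<subseteq> ?E"
    by (rule closure_minimal)
  with dense show ?thesis
    by auto
qed

text \<open>The functional \<open>\<phi> x = cinner y (f x)\<close> vanishes on a closed subspace \<open>N\<close>. If it does not vanish
  everywhere, a nonzero vector \<open>e\<close> orthogonal to \<open>N\<close> represents it up to a scalar, because
  \<open>\<phi> x *\<^sub>C e - \<phi> e *\<^sub>C x\<close> lies in \<open>N\<close>.\<close>

lemma adjoint_vector_exists:
  fixes f :: "'a::chilbert_space \<Rightarrow> 'b::chilbert_space"
  assumes f: "bounded_clinear f"
  shows "\<exists>z. \<forall>x. cinner (f x) y = cinner x z"
proof -
  define \<phi> where "\<phi> x = cinner y (f x)" for x
  have lin: "\<phi> (u + v) = \<phi> u + \<phi> v" "\<phi> (u - v) = \<phi> u - \<phi> v" "\<phi> (c *\<^sub>C u) = c * \<phi> u" "\<phi> 0 = 0"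
    for u v c
    by (simp_all add: \<phi>_def bounded_clinear_add[OF f] bounded_clinear_diff[OF f]
        bounded_clinear_scaleC[OF f] bounded_clinear_zero[OF f] cinner_add_right cinner_diff_right
        cinner_scaleC_right)
  let ?N = "{x. \<phi> x = 0}"
  have "cvec.subspace ?N"
    by (auto simp: cvec.subspace_def lin)
  moreover have "closed ?N"
    unfolding closed_sequential_limits
  proof (intro allI impI, elim conjE)
    fix X l
    assume X: "\<forall>n. X n \<in> ?N" "X \<longlonglongrightarrow> l"
    have "(\<lambda>n. \<phi> (X n)) \<longlonglongrightarrow> \<phi> l"
      unfolding \<phi>_def by (rule tendsto_cinner[OF tendsto_const bounded_clinear_tendsto[OF f X(2)]])
    with X(1) show "l \<in> ?N"
      by (simp add: LIMSEQ_const_iff)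
  qed
  ultimately have proj: "\<exists>p\<in>?N. \<forall>s\<in>?N. cinner s (x - p) = 0" for x
    by (rule orthogonal_projection_exists)
  have "\<exists>z. \<forall>x. \<phi> x = cinner z x"
  proof (cases "\<forall>x. \<phi> x = 0")
    case True
    then show ?thesis
      by (intro exI[of _ 0]) simp
  next
    case False
    then obtain x0 where x0: "\<phi> x0 \<noteq> 0"
      by blast
    obtain p where p: "\<phi> p = 0" "\<And>s. \<phi> s = 0 \<Longrightarrow> cinner s (x0 - p) = 0"
      using proj[of x0] by blast
    define e where "e = x0 - p"
    have e: "\<phi> e \<noteq> 0" "\<And>s. \<phi> s = 0 \<Longrightarrow> cinner e s = 0"
      using x0 p cinner_commute[of e] by (auto simp: e_def lin)
    then have e0: "cinner e e \<noteq> 0"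
      using lin by auto
    have "\<phi> x = cinner (cnj (\<phi> e / cinner e e) *\<^sub>C e) x" for x
    proof -
      have "\<phi> (\<phi> x *\<^sub>C e - \<phi> e *\<^sub>C x) = 0"
        by (simp add: lin)
      then have "cinner e (\<phi> x *\<^sub>C e - \<phi> e *\<^sub>C x) = 0"
        by (rule e(2))
      then show ?thesis
        using e0 by (simp add: cinner_diff_right cinner_scaleC_right cinner_scaleC_left field_simps)
    qed
    then show ?thesis
      by blast
  qed
  then show ?thesis
    unfolding \<phi>_def by (metis cinner_commute)
qed

lemma cinner_cadjoint:
  assumes "bounded_clinear f"
  shows "cinner (f x) y = cinner x (cadjoint f y)"
proof -
  have "\<exists>g. \<forall>x y. cinner (f x) y = cinner x (g y)"
    using adjoint_vector_exists[OF assms] by metis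
  then show ?thesis
    unfolding cadjoint_def by (rule someI2_ex) blast
qed

lemma bounded_clinear_cadjoint:
  assumes f: "bounded_clinear f"
  shows "bounded_clinear (cadjoint f)"
proof -
  obtain K where K: "0 < K" "\<And>x. norm (f x) \<le> norm x * K"
    using f bounded_linear.pos_bounded unfolding bounded_clinear_def by blast
  show ?thesis
  proof (rule bounded_clinearI)
    show "cadjoint f (x + y) = cadjoint f x + cadjoint f y" for x y
      by (rule cinner_ext_left) (simp add: cinner_add_right flip: cinner_cadjoint[OF f])
    show "cadjoint f (c *\<^sub>C x) = c *\<^sub>C cadjoint f x" for c x
      by (rule cinner_ext_left) (simp add: cinner_scaleC_right flip: cinner_cadjoint[OF f])
    show "norm (cadjoint f y) \<le> norm y * K" for y
    proof (cases "cadjoint f y = 0")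
      case True
      then show ?thesis
        using K(1) by simp
    next
      case False
      let ?g = "cadjoint f y"
      have "cinner (f ?g) y = complex_of_real ((norm ?g)\<^sup>2)"
        by (simp add: cinner_cadjoint[OF f] cinner_self)
      then have "(norm ?g)\<^sup>2 \<le> norm (f ?g) * norm y"
        using Cauchy_Schwarz[of "f ?g" y] by (simp add: norm_power)
      also have "\<dots> \<le> norm ?g * K * norm y"
        by (intro mult_right_mono K(2)) simp
      finally show ?thesis
        using False by (simp add: power2_eq_square mult_ac)
    qed
  qed
qed

section \<open>Families with equal Gram matrices\<close>

text \<open>The finite linear combinations of the pairs \<open>(f i, g i)\<close>: the graph of the linear map that
  sends each \<open>f i\<close> to \<open>g i\<close>. As a relation it needs no choice of coefficients; that it is
  single-valued follows from the equality of the Gram matrices.\<close>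

inductive_set pair_span :: "('i \<Rightarrow> 'a::chilbert_space) \<Rightarrow> ('i \<Rightarrow> 'b::chilbert_space) \<Rightarrow> ('a \<times> 'b) set"
  for f g where
  zero: "(0, 0) \<in> pair_span f g"
| step: "(u, v) \<in> pair_span f g \<Longrightarrow> (u + c *\<^sub>C f i, v + c *\<^sub>C g i) \<in> pair_span f g"

lemma pair_span_base: "(f i, g i) \<in> pair_span f g"
  using pair_span.step[of 0 0 f g 1 i] pair_span.zero[of f g] by (simp add: scaleC_one)

lemma pair_span_add:
  assumes "(u, v) \<in> pair_span f g" "(u', v') \<in> pair_span f g"
  shows "(u + u', v + v') \<in> pair_span f g"
  using assms(2,1)
proof (induction rule: pair_span.induct)
  case (step u' v' c i)
  then show ?case
    using pair_span.step[of "u + u'" "v + v'" f g c i] by (simp add: add.assoc)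
qed simp

lemma pair_span_scaleC:
  assumes "(u, v) \<in> pair_span f g"
  shows "(c *\<^sub>C u, c *\<^sub>C v) \<in> pair_span f g"
  using assms
proof (induction rule: pair_span.induct)
  case zero
  then show ?case
    by (simp add: pair_span.zero)
next
  case (step u v d i)
  then show ?case
    using pair_span.step[of "c *\<^sub>C u" "c *\<^sub>C v" f g "c * d" i]
    by (simp add: scaleC_add_right scaleC_scaleC)
qed

lemma pair_span_cinner:
  assumes gram: "\<And>i j. cinner (f i) (f j) = cinner (g i) (g j)"
    and "(u, v) \<in> pair_span f g" "(u', v') \<in> pair_span f g"
  shows "cinner u u' = cinner v v'"
proof -
  have base: "cinner (f i) u' = cinner (g i) v'" for i
    using assms(3)
    by induction (auto simp: cinner_add_right cinner_scaleC_right gram)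
  show ?thesis
    using assms(2)
    by induction (auto simp: cinner_add_left cinner_scaleC_left base)
qed

lemma closure_pair_sequential:
  fixes G :: "('a::metric_space \<times> 'b::metric_space) set"
  shows "(u, v) \<in> closure G \<longleftrightarrow> (\<exists>U V. (\<forall>n. (U n, V n) \<in> G) \<and> U \<longlonglongrightarrow> u \<and> V \<longlonglongrightarrow> v)"
  (is "?L \<longleftrightarrow> ?R")
proof
  assume ?L
  then obtain X where X: "\<And>n. X n \<in> G" "X \<longlonglongrightarrow> (u, v)"
    unfolding closure_sequential by blast
  then show ?R
    using tendsto_fst[OF X(2)] tendsto_snd[OF X(2)]
    by (intro exI[of _ "\<lambda>n. fst (X n)"] exI[of _ "\<lambda>n. snd (X n)"]) simp
next
  assume ?R
  then obtain U V where "\<And>n. (U n, V n) \<in> G" "U \<longlonglongrightarrow> u" "V \<longlonglongrightarrow> v"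
    by blast
  then show ?L
    unfolding closure_sequential by (intro exI[of _ "\<lambda>n. (U n, V n)"]) (simp add: tendsto_Pair)
qed

lemma closure_pair_span_add:
  assumes "(u, v) \<in> closure (pair_span f g)" "(u', v') \<in> closure (pair_span f g)"
  shows "(u + u', v + v') \<in> closure (pair_span f g)"
proof -
  obtain U V where U: "\<And>n. (U n, V n) \<in> pair_span f g" "U \<longlonglongrightarrow> u" "V \<longlonglongrightarrow> v"
    using assms(1) unfolding closure_pair_sequential by blast
  obtain U' V' where U': "\<And>n. (U' n, V' n) \<in> pair_span f g" "U' \<longlonglongrightarrow> u'" "V' \<longlonglongrightarrow> v'"
    using assms(2) unfolding closure_pair_sequential by blast
  show ?thesis
    unfolding closure_pair_sequential
    using pair_span_add[OF U(1) U'(1)] tendsto_add[OF U(2) U'(2)] tendsto_add[OF U(3) U'(3)]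
    by (intro exI[of _ "\<lambda>n. U n + U' n"] exI[of _ "\<lambda>n. V n + V' n"]) simp
qed

lemma closure_pair_span_scaleC:
  assumes "(u, v) \<in> closure (pair_span f g)"
  shows "(c *\<^sub>C u, c *\<^sub>C v) \<in> closure (pair_span f g)"
proof -
  obtain U V where U: "\<And>n. (U n, V n) \<in> pair_span f g" "U \<longlonglongrightarrow> u" "V \<longlonglongrightarrow> v"
    using assms unfolding closure_pair_sequential by blast
  note lim = bounded_clinear_tendsto[OF bounded_clinear_scaleC_op]
  show ?thesis
    unfolding closure_pair_sequential
    using pair_span_scaleC[OF U(1), of c] lim[OF U(2), of c] lim[OF U(3), of c]
    by (intro exI[of _ "\<lambda>n. c *\<^sub>C U n"] exI[of _ "\<lambda>n. c *\<^sub>C V n"]) simp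
qed

lemma closure_pair_span_cinner:
  assumes gram: "\<And>i j. cinner (f i) (f j) = cinner (g i) (g j)"
    and "(u, v) \<in> closure (pair_span f g)" "(u', v') \<in> closure (pair_span f g)"
  shows "cinner u u' = cinner v v'"
proof -
  obtain U V where U: "\<And>n. (U n, V n) \<in> pair_span f g" "U \<longlonglongrightarrow> u" "V \<longlonglongrightarrow> v"
    using assms(2) unfolding closure_pair_sequential by blast
  obtain U' V' where U': "\<And>n. (U' n, V' n) \<in> pair_span f g" "U' \<longlonglongrightarrow> u'" "V' \<longlonglongrightarrow> v'"
    using assms(3) unfolding closure_pair_sequential by blast
  have "cinner (U n) (U' n) = cinner (V n) (V' n)" for n
    using pair_span_cinner[OF gram U(1) U'(1)] .
  then show ?thesis
    using LIMSEQ_unique[OF tendsto_cinner[OF U(2) U'(2)]] tendsto_cinner[OF U(3) U'(3)] by simp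
qed

lemma closure_pair_span_norm:
  assumes "\<And>i j. cinner (f i) (f j) = cinner (g i) (g j)" "(u, v) \<in> closure (pair_span f g)"
  shows "norm u = norm v"
  using norm_sq_eq_Re_cinner[of u] norm_sq_eq_Re_cinner[of v]
    closure_pair_span_cinner[OF assms assms(2)]
  by (metis norm_ge_zero power2_eq_iff_nonneg)

lemma closure_pair_span_diff:
  assumes "(u, v) \<in> closure (pair_span f g)" "(u', v') \<in> closure (pair_span f g)"
  shows "(u - u', v - v') \<in> closure (pair_span f g)"
  using closure_pair_span_add[OF assms(1) closure_pair_span_scaleC[OF assms(2), of "-1"]]
  by (simp add: scaleC_minus_one)

lemma closure_pair_span_unique:
  assumes "\<And>i j. cinner (f i) (f j) = cinner (g i) (g j)"
    "(u, v) \<in> closure (pair_span f g)" "(u, v') \<in> closure (pair_span f g)"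
  shows "v = v'"
  using closure_pair_span_norm[OF assms(1) closure_pair_span_diff[OF assms(2,3)]] by simp

text \<open>The closed graph is isometric, so a convergent sequence of first components comes with a
  Cauchy sequence of second components: the domain is closed and every \<open>y\<close> can be projected
  onto it.\<close>

lemma projection_onto_domain_exists:
  fixes f :: "'i \<Rightarrow> 'a::chilbert_space" and g :: "'i \<Rightarrow> 'b::chilbert_space"
  assumes gram: "\<And>i j. cinner (f i) (f j) = cinner (g i) (g j)"
  shows "\<exists>p v. (p, v) \<in> closure (pair_span f g) \<and>
    (\<forall>(s, t)\<in>closure (pair_span f g). cinner s (y - p) = 0)"
proof -
  let ?G = "closure (pair_span f g)"
  let ?S = "fst ` ?G"
  have "(0, 0) \<in> ?G"
    using closure_subset pair_span.zero by blast
  then have "cvec.subspace ?S"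
    unfolding cvec.subspace_def fst_eq_Domain Domain_iff
    by (blast intro: closure_pair_span_add closure_pair_span_scaleC)
  moreover have "closed ?S"
    unfolding closed_sequential_limits
  proof (intro allI impI, elim conjE)
    fix U u
    assume "\<forall>n. U n \<in> ?S" and U: "U \<longlonglongrightarrow> u"
    then have "\<forall>n. \<exists>v. (U n, v) \<in> ?G"
      by force
    then obtain V where V: "\<And>n. (U n, V n) \<in> ?G"
      by metis
    have "dist (V m) (V n) = dist (U m) (U n)" for m n
      using closure_pair_span_norm[OF gram closure_pair_span_diff[OF V V], of m n]
      by (simp add: dist_norm)
    then have "Cauchy V"
      using LIMSEQ_imp_Cauchy[OF U] by (simp add: Cauchy_def)
    then obtain v where "V \<longlonglongrightarrow> v"
      using Cauchy_convergent convergent_def by blast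
    then have "(\<lambda>n. (U n, V n)) \<longlonglongrightarrow> (u, v)"
      using U by (intro tendsto_Pair)
    then have "(u, v) \<in> ?G"
      using V by (meson closed_closure closed_sequentially)
    then show "u \<in> ?S"
      by force
  qed
  ultimately obtain p where "p \<in> ?S" "\<forall>s\<in>?S. cinner s (y - p) = 0"
    using orthogonal_projection_exists by blast
  then show ?thesis
    by force
qed

text \<open>\<open>W\<close> is the composition of the orthogonal projection onto the closed span of the \<open>f i\<close> with the
  isometry whose graph is the closure of \<open>pair_span f g\<close>. Since that isometry preserves inner
  products, \<open>cinner (W y) (g i) = cinner (P y) (f i) = cinner y (f i)\<close> for the projection \<open>P\<close>,
  which is the claim on the adjoint.\<close>

lemma partial_isometry_of_equal_Gram:
  fixes f :: "'i \<Rightarrow> 'a::chilbert_space" and g :: "'i \<Rightarrow> 'b::chilbert_space"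
  assumes gram: "\<And>i j. cinner (f i) (f j) = cinner (g i) (g j)"
  obtains W where "partial_isometry W" "\<And>i. W (f i) = g i" "\<And>i. cadjoint W (g i) = f i"
proof -
  define G where "G = closure (pair_span f g)"
  note G_add = closure_pair_span_add[where f = f and g = g, folded G_def]
  note G_diff = closure_pair_span_diff[where f = f and g = g, folded G_def]
  note G_scaleC = closure_pair_span_scaleC[where f = f and g = g, folded G_def]
  note G_cinner = closure_pair_span_cinner[where f = f and g = g, OF gram, folded G_def]
  note G_norm = closure_pair_span_norm[where f = f and g = g, OF gram, folded G_def]
  note G_unique = closure_pair_span_unique[where f = f and g = g, OF gram, folded G_def]
  have G_base: "(f i, g i) \<in> G" for i
    unfolding G_def by (rule subsetD[OF closure_subset pair_span_base])
  have "\<exists>p v. (p, v) \<in> G \<and> (\<forall>(s, t)\<in>G. cinner s (y - p) = 0)" for y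
    unfolding G_def by (rule projection_onto_domain_exists[OF gram])
  then obtain P W where PW: "\<And>y. (P y, W y) \<in> G \<and> (\<forall>(s, t)\<in>G. cinner s (y - P y) = 0)"
    by metis
  have W: "(P y, W y) \<in> G" for y
    using PW by blast
  have P: "cinner s (y - P y) = 0" if "(s, t) \<in> G" for y s t
    using PW that by blast
  have P': "cinner (y - P y) s = 0" if "(s, t) \<in> G" for y s t
    using P[OF that] cinner_commute[of "y - P y" s] by simp
  (* Two projections of y onto the domain differ by a point of the domain that is orthogonal to
     the domain, hence to itself. *)
  have P_unique: "P y = p" if "(p, v) \<in> G" "\<And>s t. (s, t) \<in> G \<Longrightarrow> cinner s (y - p) = 0" for y p v
  proof -
    have m: "(P y - p, W y - v) \<in> G"
      using G_diff[OF W that(1)] .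
    have "cinner (P y - p) (P y - p) = cinner (P y - p) (y - p) - cinner (P y - p) (y - P y)"
      by (simp flip: cinner_diff_right)
    also have "\<dots> = 0"
      using that(2)[OF m] P[OF m] by simp
    finally show ?thesis
      by simp
  qed
  have W_eq: "W y = v" if "(p, v) \<in> G" "\<And>s t. (s, t) \<in> G \<Longrightarrow> cinner s (y - p) = 0" for y p v
  proof -
    have "P y = p"
      using that by (rule P_unique)
    then show ?thesis
      using G_unique[OF W[of y]] that(1) by simp
  qed
  have P_norm: "norm (P y) \<le> norm y" for y
  proof (cases "P y = 0")
    case False
    have "cinner (P y) y = complex_of_real ((norm (P y))\<^sup>2)"
      using P[OF W, of y y] by (simp add: cinner_diff_right cinner_self)
    then have "(norm (P y))\<^sup>2 \<le> norm (P y) * norm y"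
      using Cauchy_Schwarz[of "P y" y] by (simp add: norm_power)
    then show ?thesis
      using False by (simp add: power2_eq_square)
  qed simp
  have bW: "bounded_clinear W"
  proof (rule bounded_clinearI[where K = 1])
    show "W (x + y) = W x + W y" for x y
    proof (rule W_eq[OF G_add[OF W W]])
      show "cinner s (x + y - (P x + P y)) = 0" if "(s, t) \<in> G" for s t
        using P[OF that, of x] P[OF that, of y] by (simp add: cinner_diff_right cinner_add_right)
    qed
    show "W (c *\<^sub>C x) = c *\<^sub>C W x" for c x
    proof (rule W_eq[OF G_scaleC[OF W]])
      show "cinner s (c *\<^sub>C x - c *\<^sub>C P x) = 0" if "(s, t) \<in> G" for s t
        using P[OF that, of x] by (simp add: cinner_diff_right cinner_scaleC_right)
    qed
    show "norm (W x) \<le> norm x * 1" for x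
      using G_norm[OF W, of x] P_norm[of x] by simp
  qed
  have Wf: "W (f i) = g i" for i
    by (rule W_eq[OF G_base]) simp
  have "cadjoint W (g i) = f i" for i
  proof (rule cinner_ext_left)
    fix y
    have "cinner y (cadjoint W (g i)) = cinner (W y) (g i)"
      by (simp add: cinner_cadjoint[OF bW])
    also have "\<dots> = cinner (P y) (f i)"
      using G_cinner[OF W G_base] by simp
    also have "\<dots> = cinner y (f i)"
      using P'[OF G_base, of y i] by (simp add: cinner_diff_left)
    finally show "cinner y (cadjoint W (g i)) = cinner y (f i)" .
  qed
  moreover have "partial_isometry W"
    unfolding partial_isometry_def
  proof (intro conjI bW allI impI)
    fix x
    assume x: "\<forall>y. W y = 0 \<longrightarrow> cinner y x = 0"
    have "W (P x) = W x"
      by (rule W_eq[OF W]) simp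
    then have "W (x - P x) = 0"
      by (simp add: bounded_clinear_diff[OF bW])
    then have "cinner (x - P x) x = 0"
      using x by blast
    moreover have "cinner (x - P x) (P x) = 0"
      by (rule P'[OF W])
    ultimately have "cinner (x - P x) (x - P x) = 0"
      by (simp add: cinner_diff_right)
    then show "norm (W x) = norm x"
      using G_norm[OF W, of x] by simp
  qed
  ultimately show ?thesis
    using that Wf by blast
qed

section \<open>Module maps and dilations\<close>

lemma module_map_bounded: "module_map ip \<psi> \<Phi> \<Longrightarrow> bounded_clinear (\<Phi> x)"
  by (simp add: module_map_def)

lemma module_map_cinner:
  assumes "module_map ip \<psi> \<Phi>"
  shows "cinner (\<Phi> x h) (\<Phi> y k) = cinner h (\<psi> (ip x y) k)"
proof -
  have "cinner (\<Phi> x h) (\<Phi> y k) = cinner h (cadjoint (\<Phi> x) (\<Phi> y k))"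
    by (rule cinner_cadjoint[OF module_map_bounded[OF assms]])
  also have "cadjoint (\<Phi> x) (\<Phi> y k) = \<psi> (ip x y) k"
    using assms by (simp add: module_map_def fun_eq_iff)
  finally show ?thesis .
qed

text \<open>The difference \<open>\<Theta> (act x a) k - \<Theta> x (\<pi> a k)\<close> lies in the span of the ranges of the operators
  \<open>\<Theta> y\<close>, and it is orthogonal to each of these ranges because
  \<open>\<pi> (ip y (act x a)) = \<pi> (ip y x) \<circ> \<pi> a\<close>.\<close>

lemma module_map_act:
  assumes mod: "hilbert_module act ip" and map: "module_map ip \<pi> \<Theta>"
    and mult: "\<And>a b. \<pi> (a * b) = \<pi> a \<circ> \<pi> b"
  shows "\<Theta> (act x a) k = \<Theta> x (\<pi> a k)"
proof -
  let ?D = "\<Theta> (act x a) k - \<Theta> x (\<pi> a k)"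
  have "ip y (act x a) = ip y x * a" for y
    using mod by (rule hilbert_module.ip_act_right)
  then have orth: "cinner (\<Theta> y l) ?D = 0" for y l
    by (simp add: cinner_diff_right module_map_cinner[OF map] mult)
  have "cinner ?D ?D = cinner (\<Theta> (act x a) k) ?D - cinner (\<Theta> x (\<pi> a k)) ?D"
    by (rule cinner_diff_left)
  also have "\<dots> = 0"
    by (simp only: orth diff_self)
  finally show ?thesis
    by simp
qed

lemma minimal_stinespring_eqI:
  assumes dil: "minimal_stinespring \<phi> \<pi> V" and "bounded_clinear F" "bounded_clinear G"
    and "\<And>a h. F (\<pi> a (V h)) = G (\<pi> a (V h))"
  shows "F = G"
proof (rule bounded_clinear_eq_on_dense_cspan)
  show "closure (cspan {\<pi> a (V h) | a h. True}) = UNIV"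
    using dil by (simp add: minimal_stinespring_def)
qed (use assms in auto)

text \<open>The vectors \<open>\<Phi> x h\<close> and \<open>\<Theta> x (V h)\<close> have the same Gram matrix, since both inner products
  equal \<open>cinner (V h) (\<pi> (ip x y) (V k))\<close>. The final space of the resulting partial isometry
  contains all of \<open>\<Theta> x\<close>'s range, because \<open>\<Theta> x (\<pi> a (V h)) = \<Theta> (act x a) (V h)\<close> and the vectors
  \<open>\<pi> a (V h)\<close> are total.\<close>

lemma intertwining_partial_isometry_exists:
  fixes \<Phi> :: "'x::{complex_normed_vector, complete_space} \<Rightarrow> 'h::chilbert_space \<Rightarrow> 'kt::chilbert_space"
    and \<Theta> :: "'x \<Rightarrow> 'hphi::chilbert_space \<Rightarrow> 'k::chilbert_space"
  assumes dil: "minimal_stinespring \<phi> \<pi> V" and mod: "hilbert_module act ip"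
    and rep: "module_representation ip \<pi> \<Theta>" and map: "module_map ip \<phi> \<Phi>"
  obtains W :: "'kt \<Rightarrow> 'k" where "partial_isometry W"
    "\<And>x h. W (\<Phi> x h) = \<Theta> x (V h)" "\<And>x h. cadjoint W (\<Theta> x (V h)) = \<Phi> x h"
    "\<And>x v. W (cadjoint W (\<Theta> x v)) = \<Theta> x v"
proof -
  have V: "bounded_clinear V" and \<phi>: "\<phi> a h = cadjoint V (\<pi> a (V h))" for a h
    using dil by (auto simp: minimal_stinespring_def)
  have \<Theta>: "module_map ip \<pi> \<Theta>" and mult: "\<pi> (a * b) = \<pi> a \<circ> \<pi> b" for a b
    using rep by (auto simp: module_representation_def star_representation_def)
  have "cinner (\<Phi> x h) (\<Phi> y k) = cinner (\<Theta> x (V h)) (\<Theta> y (V k))" for x y h k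
    by (simp add: module_map_cinner[OF map] module_map_cinner[OF \<Theta>] \<phi> cinner_cadjoint[OF V])
  then obtain W :: "'kt \<Rightarrow> 'k" where W: "partial_isometry W"
    and W\<Phi>: "\<And>i. W (case i of (x, h) \<Rightarrow> \<Phi> x h) = (case i of (x, h) \<Rightarrow> \<Theta> x (V h))"
    and W\<Theta>: "\<And>i. cadjoint W (case i of (x, h) \<Rightarrow> \<Theta> x (V h)) = (case i of (x, h) \<Rightarrow> \<Phi> x h)"
    using partial_isometry_of_equal_Gram[where f = "\<lambda>(x, h). \<Phi> x h" and g = "\<lambda>(x, h). \<Theta> x (V h)"]
    by (metis (mono_tags, lifting) case_prod_beta)
  have W1: "W (\<Phi> x h) = \<Theta> x (V h)" and W2: "cadjoint W (\<Theta> x (V h)) = \<Phi> x h" for x h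
    using W\<Phi>[of "(x, h)"] W\<Theta>[of "(x, h)"] by auto
  have bW: "bounded_clinear W"
    using W by (simp add: partial_isometry_def)
  have "W \<circ> (cadjoint W \<circ> \<Theta> x) = \<Theta> x" for x
  proof (rule minimal_stinespring_eqI[OF dil])
    show "bounded_clinear (W \<circ> (cadjoint W \<circ> \<Theta> x))"
      by (intro bounded_clinear_compose bW bounded_clinear_cadjoint module_map_bounded[OF \<Theta>])
    show "(W \<circ> (cadjoint W \<circ> \<Theta> x)) (\<pi> a (V h)) = \<Theta> x (\<pi> a (V h))" for a h
      by (simp add: W1 W2 flip: module_map_act[OF mod \<Theta> mult])
  qed (rule module_map_bounded[OF \<Theta>])
  then have "W (cadjoint W (\<Theta> x v)) = \<Theta> x v" for x v
    by (simp add: fun_eq_iff)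
  with that W W1 W2 show ?thesis
    by blast
qed

text \<open>With \<open>W\<close> intertwining the two maps, membership says that
  \<open>\<Theta> x (\<pi> b (V h)) = \<Theta> x (V (cadjoint V (\<pi> b (V h))))\<close> for all \<open>b\<close> and \<open>h\<close>. This does not mention the
  chosen \<open>\<phi>\<close>-map any more.\<close>

lemma ternary_domain_iff_dilation_vanishes:
  assumes dil: "minimal_stinespring \<phi> \<pi> V" and mod: "hilbert_module act ip"
    and rep: "module_representation ip \<pi> \<Theta>" and map: "module_map ip \<phi> \<Phi>"
  shows "x \<in> ternary_domain act \<phi> \<Phi> \<longleftrightarrow> \<Theta> x \<circ> (\<lambda>v. v - V (cadjoint V v)) = (\<lambda>v. 0)"
proof -
  obtain W where W\<Phi>: "\<And>x h. W (\<Phi> x h) = \<Theta> x (V h)"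
    and W\<Theta>: "\<And>x h. cadjoint W (\<Theta> x (V h)) = \<Phi> x h"
    using intertwining_partial_isometry_exists[OF assms] by metis
  have V: "bounded_clinear V" and \<phi>: "\<phi> a h = cadjoint V (\<pi> a (V h))" for a h
    using dil by (auto simp: minimal_stinespring_def)
  have \<Theta>: "module_map ip \<pi> \<Theta>" and mult: "\<pi> (a * b) = \<pi> a \<circ> \<pi> b" for a b
    using rep by (auto simp: module_representation_def star_representation_def)
  note b\<Theta> = module_map_bounded[OF \<Theta>]
  have "x \<in> ternary_domain act \<phi> \<Phi> \<longleftrightarrow> (\<forall>b h. \<Phi> (act x b) h = \<Phi> x (\<phi> b h))"
    by (auto simp: ternary_domain_def fun_eq_iff)
  also have "\<dots> \<longleftrightarrow> (\<forall>b h. \<Theta> (act x b) (V h) = \<Theta> x (V (\<phi> b h)))"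
    by (metis W\<Phi> W\<Theta>)
  also have "\<dots> \<longleftrightarrow> (\<forall>b h. \<Theta> x (\<pi> b (V h)) = \<Theta> x (V (cadjoint V (\<pi> b (V h)))))"
    by (simp add: module_map_act[OF mod \<Theta> mult] \<phi>)
  also have "\<dots> \<longleftrightarrow> \<Theta> x = \<Theta> x \<circ> (V \<circ> cadjoint V)"
  proof
    assume "\<forall>b h. \<Theta> x (\<pi> b (V h)) = \<Theta> x (V (cadjoint V (\<pi> b (V h))))"
    then show "\<Theta> x = \<Theta> x \<circ> (V \<circ> cadjoint V)"
      by (intro minimal_stinespring_eqI[OF dil] bounded_clinear_compose b\<Theta> V
          bounded_clinear_cadjoint) simp
  qed (metis comp_apply)
  also have "\<dots> \<longleftrightarrow> \<Theta> x \<circ> (\<lambda>v. v - V (cadjoint V v)) = (\<lambda>v. 0)"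
    by (simp add: fun_eq_iff bounded_clinear_diff[OF b\<Theta>])
  finally show ?thesis .
qed

theorem corollary4p6:
  fixes \<phi> :: "'a::cstar_algebra \<Rightarrow> 'h::chilbert_space \<Rightarrow> 'h"
    and \<pi> :: "'a \<Rightarrow> 'hphi::chilbert_space \<Rightarrow> 'hphi"
    and V :: "'h \<Rightarrow> 'hphi"
    and act :: "'x::{complex_normed_vector, complete_space} \<Rightarrow> 'a \<Rightarrow> 'x"
    and ip :: "'x \<Rightarrow> 'x \<Rightarrow> 'a"
    and \<Theta> :: "'x \<Rightarrow> 'hphi \<Rightarrow> 'k::chilbert_space"
    and \<Phi> :: "'x \<Rightarrow> 'h \<Rightarrow> 'kt::chilbert_space"
  assumes "completely_positive \<phi>"
    and "minimal_stinespring \<phi> \<pi> V"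
    and "hilbert_module act ip"
    and "module_representation ip \<pi> \<Theta>"
    and "module_map ip \<phi> \<Phi>"
  shows "\<exists>W :: 'kt \<Rightarrow> 'k. partial_isometry W \<and>
    (\<forall>x. \<Phi> x = cadjoint W \<circ> \<Theta> x \<circ> V) \<and>
    (\<forall>x.
      (\<forall>\<Phi>' :: 'x \<Rightarrow> 'h \<Rightarrow> 'kp::chilbert_space. module_map ip \<phi> \<Phi>' \<longrightarrow>
         (x \<in> ternary_domain act \<phi> \<Phi>' \<longleftrightarrow>
            \<Theta> x \<circ> (\<lambda>v. v - V (cadjoint V v)) = (\<lambda>v. 0))) \<and>
      (\<Theta> x \<circ> (\<lambda>v. v - V (cadjoint V v)) = (\<lambda>v. 0) \<longleftrightarrow>
         cadjoint W \<circ> \<Theta> x = \<Phi> x \<circ> cadjoint V) \<and>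
      (cadjoint W \<circ> \<Theta> x = \<Phi> x \<circ> cadjoint V \<longleftrightarrow>
         \<Theta> x = W \<circ> \<Phi> x \<circ> cadjoint V))"
proof -
  have \<Theta>: "bounded_clinear (\<Theta> x)" for x
    using assms(4) by (auto simp: module_representation_def module_map_def)
  obtain W :: "'kt \<Rightarrow> 'k" where W: "partial_isometry W"
    and W\<Phi>: "\<And>x h. W (\<Phi> x h) = \<Theta> x (V h)"
    and W\<Theta>: "\<And>x h. cadjoint W (\<Theta> x (V h)) = \<Phi> x h"
    and WW: "\<And>x v. W (cadjoint W (\<Theta> x v)) = \<Theta> x v"
    using intertwining_partial_isometry_exists[OF assms(2,3,4,5)] by blast
  have vanish: "\<Theta> x \<circ> (\<lambda>v. v - V (cadjoint V v)) = (\<lambda>v. 0)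
      \<longleftrightarrow> (\<forall>v. \<Theta> x v = \<Theta> x (V (cadjoint V v)))" for x
    by (simp add: fun_eq_iff bounded_clinear_diff[OF \<Theta>])
  show ?thesis
  proof (intro exI[of _ W] conjI allI impI)
    show "partial_isometry W"
      by (rule W)
    show "\<Phi> x = cadjoint W \<circ> \<Theta> x \<circ> V" for x
      by (simp add: fun_eq_iff W\<Theta>)
    show "x \<in> ternary_domain act \<phi> \<Phi>' \<longleftrightarrow> \<Theta> x \<circ> (\<lambda>v. v - V (cadjoint V v)) = (\<lambda>v. 0)"
      if "module_map ip \<phi> \<Phi>'" for x and \<Phi>' :: "'x \<Rightarrow> 'h \<Rightarrow> 'kp::chilbert_space"
      by (rule ternary_domain_iff_dilation_vanishes[OF assms(2,3,4) that])
    (* Each side turns into the other on applying W or its adjoint, because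
       WW* fixes the range of \<Theta> x and W*W fixes that of \<Phi> x. *)
    show "\<Theta> x \<circ> (\<lambda>v. v - V (cadjoint V v)) = (\<lambda>v. 0)
        \<longleftrightarrow> cadjoint W \<circ> \<Theta> x = \<Phi> x \<circ> cadjoint V" for x
      unfolding vanish by (simp add: fun_eq_iff) (metis W\<Phi> W\<Theta> WW)
    show "cadjoint W \<circ> \<Theta> x = \<Phi> x \<circ> cadjoint V \<longleftrightarrow> \<Theta> x = W \<circ> \<Phi> x \<circ> cadjoint V" for x
      by (simp add: fun_eq_iff) (metis W\<Phi> W\<Theta> WW)
  qed
qed

end
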